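(* Suppose that the penalty $J$ satisfies $$J(uv)\le J(u)+J(v),\qquad J(u)=J\left(\frac1u\right),\qquad J(1)=0\qquad\text{for any }u,v\in\operatorname{dom}J,$$ that $H(f^\delta,f)\le\delta^2$ with $\delta>0$, and that the iterates $x_k$ of the multiplicative multiscale hierarchical decomposition method (MHDM) are well-defined. Then for any $k\ge0$, $$H(f^\delta,Tx_k)\le\delta^2+\frac{2J(z)}{(k+1)\lambda_0}.$$
   Context: $\Omega\subseteq\mathbb{R}^2$ is a domain, $T:L^2(\Omega)\to L^2(\Omega)$ is a bounded linear operator, $f\in L^2(\Omega)$ is the exact data, $f^\delta$ is the noisy data, $\delta>0$ is the noise level, and $z$ is a clean image satisfying $Tz=f$ and $J(z)<\infty$, where $J:L^2(\Omega)\to[0,\infty]$ is a proper function (the penalty) and $\operatorname{dom}J=\{u\in L^2(\Omega):J(u)<\infty\}$. The assumed properties of $J$ are understood to include that $uv$ and $1/u$ make sense and belong to $\operatorname{dom}J$ for $u,v\in\operatorname{dom}J$. $H$ is a non-negative data fitting term (values in $[0,\infty]$). Multiplicative MHDM: let $\lambda_0>0$ and $\lambda_{k+1}=2\lambda_k$ for $k\ge0$; set $x_{-1}=1$ and, for $k\ge0$, $x_{k-1}=\prod_{j=0}^{k-1}u_j$, where $$u_k\in\arg\min_uE_k(u),\qquad E_k(u)=\lambda_kH(f^\delta,T(ux_{k-1}))+J(u).$$ "The iterates are well-defined" means that for every $k\ge0$ such a minimizer $u_k$ exists (not necessarily unique; some choice is fixed) and the functions $x_k$ are such that all expressions $Tx_k$,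 $H(f^\delta,Tx_k)$ make sense. The minimization is over all $u\in L^2(\Omega)$ for which $E_k(u)$ makes sense ($ux_{k-1}\in L^2(\Omega)$). *)

theory Defs
  imports "HOL-Analysis.Analysis"
begin

type_synonym planefun = "real ^ 2 \<Rightarrow> real"

text \<open>
  Elements of \<open>L\<^sup>2(\<Omega>)\<close> are represented by square-integrable functions; equality in \<open>L\<^sup>2(\<Omega>)\<close> is
  equality almost everywhere on \<open>\<Omega>\<close>. Values outside \<open>\<Omega>\<close> are irrelevant. Everything defined on
  \<open>L\<^sup>2(\<Omega>)\<close> is therefore required to respect equality almost everywhere.
\<close>

definition ae_eq :: "(real ^ 2) set \<Rightarrow> planefun \<Rightarrow> planefun \<Rightarrow> bool" where
  "ae_eq \<Omega> u v \<longleftrightarrow> (AE t in lebesgue_on \<Omega>. u t = v t)"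

definition L2 :: "(real ^ 2) set \<Rightarrow> planefun set" where
  "L2 \<Omega> = {u \<in> borel_measurable (lebesgue_on \<Omega>). integrable (lebesgue_on \<Omega>) (\<lambda>t. (u t)\<^sup>2)}"

definition L2_norm :: "(real ^ 2) set \<Rightarrow> planefun \<Rightarrow> real" where
  "L2_norm \<Omega> u = sqrt (\<integral>t. (u t)\<^sup>2 \<partial>lebesgue_on \<Omega>)"

definition bounded_linear_L2 :: "(real ^ 2) set \<Rightarrow> (planefun \<Rightarrow> planefun) \<Rightarrow> bool" where
  "bounded_linear_L2 \<Omega> T \<longleftrightarrow>
     (\<forall>u \<in> L2 \<Omega>. T u \<in> L2 \<Omega>) \<and>
     (\<forall>u \<in> L2 \<Omega>. \<forall>v \<in> L2 \<Omega>. ae_eq \<Omega> u v \<longrightarrow> ae_eq \<Omega> (T u) (T v)) \<and>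
     (\<forall>u \<in> L2 \<Omega>. \<forall>v \<in> L2 \<Omega>. ae_eq \<Omega> (T (\<lambda>t. u t + v t)) (\<lambda>t. T u t + T v t)) \<and>
     (\<forall>c. \<forall>u \<in> L2 \<Omega>. ae_eq \<Omega> (T (\<lambda>t. c * u t)) (\<lambda>t. c * T u t)) \<and>
     (\<exists>C. \<forall>u \<in> L2 \<Omega>. L2_norm \<Omega> (T u) \<le> C * L2_norm \<Omega> u)"

definition functional_on_L2 :: "(real ^ 2) set \<Rightarrow> (planefun \<Rightarrow> ennreal) \<Rightarrow> bool" where
  "functional_on_L2 \<Omega> F \<longleftrightarrow> (\<forall>u \<in> L2 \<Omega>. \<forall>v \<in> L2 \<Omega>. ae_eq \<Omega> u v \<longrightarrow> F u = F v)"

text \<open>Only the values of \<open>J\<close> on \<open>L2 \<Omega>\<close> are meaningful, hence membership in \<open>L2 \<Omega>\<close> is part of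
  belonging to the effective domain.\<close>

definition domJ :: "(real ^ 2) set \<Rightarrow> (planefun \<Rightarrow> ennreal) \<Rightarrow> planefun set" where
  "domJ \<Omega> J = {u \<in> L2 \<Omega>. J u < \<infinity>}"

definition proper_penalty :: "(real ^ 2) set \<Rightarrow> (planefun \<Rightarrow> ennreal) \<Rightarrow> bool" where
  "proper_penalty \<Omega> J \<longleftrightarrow> functional_on_L2 \<Omega> J \<and> domJ \<Omega> J \<noteq> {}"

text \<open>
  Since \<open>1 / 0 = 0\<close> in HOL, that \<open>1 / u\<close> makes sense is expressed by \<open>u \<noteq> 0\<close> almost everywhere.
  The condition on the constant \<open>1\<close> includes \<open>1 \<in> L2 \<Omega>\<close>, i.e. \<open>\<Omega>\<close> has finite measure.
\<close>

definition multiplicative_penalty :: "(real ^ 2) set \<Rightarrow> (planefun \<Rightarrow> ennreal) \<Rightarrow> bool" where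
  "multiplicative_penalty \<Omega> J \<longleftrightarrow>
     (\<forall>u \<in> domJ \<Omega> J. \<forall>v \<in> domJ \<Omega> J.
        (\<lambda>t. u t * v t) \<in> domJ \<Omega> J \<and> J (\<lambda>t. u t * v t) \<le> J u + J v) \<and>
     (\<forall>u \<in> domJ \<Omega> J.
        (AE t in lebesgue_on \<Omega>. u t \<noteq> 0) \<and>
        (\<lambda>t. 1 / u t) \<in> domJ \<Omega> J \<and> J u = J (\<lambda>t. 1 / u t)) \<and>
     (\<lambda>t. 1) \<in> L2 \<Omega> \<and> J (\<lambda>t. 1) = 0"

primrec mhdm_lambda :: "real \<Rightarrow> nat \<Rightarrow> real" where
  "mhdm_lambda lam0 0 = lam0"
| "mhdm_lambda lam0 (Suc k) = 2 * mhdm_lambda lam0 k"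

definition mhdm_x :: "(nat \<Rightarrow> planefun) \<Rightarrow> nat \<Rightarrow> planefun" where
  "mhdm_x u k = (\<lambda>t. \<Prod>j\<le>k. u j t)"

text \<open>\<open>mhdm_x_prev u k\<close> is \<open>x\<^bsub>k-1\<^esub>\<close>, with \<open>x\<^bsub>-1\<^esub> = 1\<close>.\<close>

definition mhdm_x_prev :: "(nat \<Rightarrow> planefun) \<Rightarrow> nat \<Rightarrow> planefun" where
  "mhdm_x_prev u k = (case k of 0 \<Rightarrow> (\<lambda>t. 1) | Suc m \<Rightarrow> mhdm_x u m)"

definition mhdm_energy ::
  "(planefun \<Rightarrow> planefun) \<Rightarrow> (planefun \<Rightarrow> ennreal) \<Rightarrow> (planefun \<Rightarrow> planefun \<Rightarrow> ennreal) \<Rightarrow> planefun \<Rightarrow>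
   real \<Rightarrow> planefun \<Rightarrow> planefun \<Rightarrow> ennreal" where
  "mhdm_energy T J H f\<delta> lam x w = ennreal lam * H f\<delta> (T (\<lambda>t. w t * x t)) + J w"

text \<open>The sequence \<open>u\<close> is a fixed choice of minimizers; their existence for every \<open>k\<close>, together with
  \<open>x\<^bsub>k\<^esub> \<in> L2 \<Omega>\<close> (contained in the constraint on \<open>u k\<close>), is the well-definedness of the iterates.\<close>

definition mhdm_minimizers ::
  "(real ^ 2) set \<Rightarrow> (planefun \<Rightarrow> planefun) \<Rightarrow> (planefun \<Rightarrow> ennreal) \<Rightarrow>
   (planefun \<Rightarrow> planefun \<Rightarrow> ennreal) \<Rightarrow> planefun \<Rightarrow> real \<Rightarrow> (nat \<Rightarrow> planefun) \<Rightarrow> bool" where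
  "mhdm_minimizers \<Omega> T J H f\<delta> lam0 u \<longleftrightarrow>
     (\<forall>k. is_arg_min (mhdm_energy T J H f\<delta> (mhdm_lambda lam0 k) (mhdm_x_prev u k))
            (\<lambda>w. w \<in> L2 \<Omega> \<and> (\<lambda>t. w t * mhdm_x_prev u k t) \<in> L2 \<Omega>) (u k))"

end

theory Submission
  imports Defs
begin

text \<open>
  Testing the minimality of \<open>u\<^sub>k\<close> against \<open>z / x\<^bsub>k-1\<^esub>\<close> and against \<open>1\<close> gives, with
  \<open>h\<^sub>k = H(f\<^sup>\<delta>, T x\<^sub>k)\<close> and \<open>Y\<^sub>k = J(z / x\<^bsub>k-1\<^esub>)\<close>, the bound
  \<open>\<lambda>\<^sub>k h\<^sub>k + J(u\<^sub>k) \<le> \<lambda>\<^sub>k H(f\<^sup>\<delta>, f) + Y\<^sub>k\<close> and the monotonicity of \<open>h\<close>. Since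
  \<open>z / x\<^sub>k = (z / x\<^bsub>k-1\<^esub>) (1 / u\<^sub>k)\<close>, also \<open>Y\<^bsub>k+1\<^esub> \<le> Y\<^sub>k + J(u\<^sub>k)\<close>, so that
  \<open>Y\<^bsub>k+1\<^esub> \<le> 2 Y\<^sub>k - \<lambda>\<^sub>k (h\<^sub>k - H(f\<^sup>\<delta>, f))\<close>. Because \<open>\<lambda>\<^bsub>k+1\<^esub> = 2 \<lambda>\<^sub>k\<close>, dividing by \<open>\<lambda>\<^bsub>k+1\<^esub>\<close> makes
  this telescope, and the sum of the excesses is at least \<open>k + 1\<close> times the last one.
\<close>

lemma mhdm_lambda_pos: "lam0 > 0 \<Longrightarrow> mhdm_lambda lam0 k > 0"
  by (induction k) auto

lemma mhdm_x_prev_0 [simp]: "mhdm_x_prev u 0 = (\<lambda>t. 1)"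
  by (simp add: mhdm_x_prev_def)

lemma mhdm_x_eq_prev: "mhdm_x u k = mhdm_x_prev u (Suc k)"
  by (simp add: mhdm_x_prev_def)

lemma mhdm_x_prev_Suc: "mhdm_x_prev u (Suc k) = (\<lambda>t. u k t * mhdm_x_prev u k t)"
  by (cases k) (auto simp: mhdm_x_prev_def mhdm_x_def mult.commute)

text \<open>The part of the argument that needs subtraction: the excess \<open>h i - d\<close> may
  be negative, so it is stated over the reals and not over \<open>ennreal\<close>.\<close>

lemma doubling_decay:
  fixes h j Y :: "nat \<Rightarrow> real"
  assumes lam0: "lam0 > 0"
    and min: "\<And>k. mhdm_lambda lam0 k * h k + j k \<le> mhdm_lambda lam0 k * d + Y k"
    and Y_Suc: "\<And>k. Y (Suc k) \<le> Y k + j k"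
    and Y_nonneg: "\<And>k. Y k \<ge> 0"
    and h_Suc: "\<And>k. h (Suc k) \<le> h k"
  shows "h k \<le> d + 2 * Y 0 / (real (k + 1) * lam0)"
proof -
  \<comment> \<open>The weight 1/2 on the excesses is the ratio of consecutive values of
    \<open>mhdm_lambda\<close>. It is the source of the factor 2 in the final bound.\<close>
  have telescope: "Y n / mhdm_lambda lam0 n + (\<Sum>i<n. h i - d) / 2 \<le> Y 0 / lam0" for n
  proof (induction n)
    case 0
    show ?case by simp
  next
    case (Suc n)
    have pos: "mhdm_lambda lam0 n > 0" using lam0 by (rule mhdm_lambda_pos)
    have "Y (Suc n) \<le> 2 * Y n - mhdm_lambda lam0 n * (h n - d)"
      using min[of n] Y_Suc[of n] by (simp add: algebra_simps)
    then have "Y (Suc n) / mhdm_lambda lam0 (Suc n) \<le> Y n / mhdm_lambda lam0 n - (h n - d) / 2"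
      using pos by (simp add: field_simps)
    then show ?case using Suc by (simp add: add_divide_distrib)
  qed
  \<comment> \<open>\<open>telescope\<close> at \<open>Suc k\<close> sums the excesses of
    \<open>h 0\<close> up to \<open>h k\<close>, which are exactly \<open>k + 1\<close>
    terms.\<close>
  have "real (k + 1) * (h k - d) = (\<Sum>i<Suc k. h k - d)" by simp
  also have "\<dots> \<le> (\<Sum>i<Suc k. h i - d)"
    using decseqD[OF decseq_SucI[of h, OF h_Suc]] by (intro sum_mono) auto
  also have "\<dots> \<le> 2 * Y 0 / lam0"
  proof -
    have "Y (Suc k) / mhdm_lambda lam0 (Suc k) \<ge> 0"
      using Y_nonneg[of "Suc k"] mhdm_lambda_pos[OF lam0, of "Suc k"] by (intro divide_nonneg_pos)
    then show ?thesis using telescope[of "Suc k"] by linarith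
  qed
  finally have "h k - d \<le> 2 * Y 0 / lam0 / real (k + 1)"
    by (subst pos_le_divide_eq) (auto simp: mult.commute)
  then show ?thesis by (simp add: mult.commute)
qed

lemma mhdm_energy_minimizer_le:
  assumes "mhdm_minimizers \<Omega> T J H f\<delta> lam0 u"
    and "w \<in> L2 \<Omega>" and "(\<lambda>t. w t * mhdm_x_prev u k t) \<in> L2 \<Omega>"
  shows "ennreal (mhdm_lambda lam0 k) * H f\<delta> (T (mhdm_x u k)) + J (u k)
    \<le> ennreal (mhdm_lambda lam0 k) * H f\<delta> (T (\<lambda>t. w t * mhdm_x_prev u k t)) + J w"
proof -
  have "mhdm_energy T J H f\<delta> (mhdm_lambda lam0 k) (mhdm_x_prev u k) (u k)
    \<le> mhdm_energy T J H f\<delta> (mhdm_lambda lam0 k) (mhdm_x_prev u k) w"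
    using assms by (auto simp: mhdm_minimizers_def is_arg_min_linorder)
  then show ?thesis by (simp add: mhdm_energy_def mhdm_x_eq_prev mhdm_x_prev_Suc)
qed

theorem proposition4p3:
  fixes \<Omega> :: "(real ^ 2) set"
    and T :: "planefun \<Rightarrow> planefun"
    and J :: "planefun \<Rightarrow> ennreal"
    and H :: "planefun \<Rightarrow> planefun \<Rightarrow> ennreal"
    and f f\<delta> z :: planefun
    and \<delta> lam0 :: real
    and u :: "nat \<Rightarrow> planefun"
  assumes "open \<Omega>" and "connected \<Omega>" and "\<Omega> \<noteq> {}"
    and "bounded_linear_L2 \<Omega> T"
    and "proper_penalty \<Omega> J"
    and "multiplicative_penalty \<Omega> J"
    and "functional_on_L2 \<Omega> (H f\<delta>)"
    and "f \<in> L2 \<Omega>" and "z \<in> L2 \<Omega>" and "ae_eq \<Omega> (T z) f" and "J z < \<infinity>"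
    and "\<delta> > 0" and "H f\<delta> f \<le> ennreal (\<delta>\<^sup>2)"
    and "lam0 > 0"
    and "mhdm_minimizers \<Omega> T J H f\<delta> lam0 u"
  shows "\<forall>k. H f\<delta> (T (mhdm_x u k)) \<le> ennreal (\<delta>\<^sup>2) + 2 * J z / ennreal (real (k + 1) * lam0)"
proof -
  let ?lam = "mhdm_lambda lam0" and ?x = "mhdm_x_prev u"
  define h where "h k = H f\<delta> (T (mhdm_x u k))" for k
  define Y where "Y k = J (\<lambda>t. z t / ?x k t)" for k
  have mult: "(\<lambda>t. v t * w t) \<in> domJ \<Omega> J" "J (\<lambda>t. v t * w t) \<le> J v + J w"
    and inverse: "(\<lambda>t. 1 / v t) \<in> domJ \<Omega> J" "J (\<lambda>t. 1 / v t) = J v"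
    and nonzero: "AE t in lebesgue_on \<Omega>. v t \<noteq> 0"
    if "v \<in> domJ \<Omega> J" "w \<in> domJ \<Omega> J" for v w
    using assms(6) that unfolding multiplicative_penalty_def by metis+
  have one: "(\<lambda>t. 1) \<in> domJ \<Omega> J" "J (\<lambda>t. 1) = 0"
  proof -
    have "(\<lambda>t. 1) \<in> L2 \<Omega>" and "J (\<lambda>t. 1) = 0"
      using assms(6) unfolding multiplicative_penalty_def by blast+
    then show "(\<lambda>t. 1) \<in> domJ \<Omega> J" "J (\<lambda>t. 1) = 0" by (simp_all add: domJ_def)
  qed
  have z: "z \<in> domJ \<Omega> J" using assms(9,11) by (simp add: domJ_def)
  have lam_pos: "?lam k > 0" for k using assms(14) by (rule mhdm_lambda_pos)
  have d_fin: "H f\<delta> f < \<infinity>" using assms(13) by (auto intro: order.strict_trans1)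

  have quot: "(\<lambda>t. z t / ?x k t) \<in> domJ \<Omega> J" if "?x k \<in> domJ \<Omega> J" for k
    using mult(1)[OF z inverse(1)[OF that that]] by simp
  have min_z: "ennreal (?lam k) * h k + J (u k) \<le> ennreal (?lam k) * H f\<delta> f + Y k"
    if x: "?x k \<in> domJ \<Omega> J" for k
  proof -
    \<comment> \<open>Where \<open>?x k\<close> vanishes, division by zero makes \<open>?w\<close>
      zero, so \<open>?w\<close> agrees with \<open>z\<close> only almost everywhere. Hence
      \<open>T\<close> and \<open>H\<close> are compared through \<open>ae_eq\<close>.\<close>
    let ?w = "\<lambda>t. z t / ?x k t * ?x k t"
    have w: "?w \<in> L2 \<Omega>" using mult(1)[OF quot[OF x] x] by (simp add: domJ_def)
    have "ae_eq \<Omega> ?w z"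
      using nonzero[OF x x] unfolding ae_eq_def by (rule AE_mp) (simp add: AE_I2)
    then have "ae_eq \<Omega> (T ?w) (T z)" and T: "T ?w \<in> L2 \<Omega>"
      using assms(4,9) w unfolding bounded_linear_L2_def by blast+
    then have "ae_eq \<Omega> (T ?w) f"
      using assms(10) unfolding ae_eq_def by (auto elim: eventually_elim2)
    then have "H f\<delta> (T ?w) = H f\<delta> f"
      using assms(7,8) T unfolding functional_on_L2_def by blast
    then show ?thesis
      using mhdm_energy_minimizer_le[OF assms(15) _ w] quot[OF x] by (simp add: h_def Y_def domJ_def)
  qed
  \<comment> \<open>Induction on \<open>k\<close>: if \<open>?x k\<close> lies in the domain, the
    competitor \<open>z / ?x k\<close> has finite energy, so the minimal energy is finite as well.
    This bounds \<open>J (u k)\<close> and, as \<open>?lam k\<close> is positive,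
    \<open>h k\<close>; the product of \<open>u k\<close> and \<open>?x k\<close> then stays in the
    domain.\<close>
  have x_dom: "?x k \<in> domJ \<Omega> J" and u_dom: "u k \<in> domJ \<Omega> J" and h_fin: "h k < \<infinity>" for k
  proof -
    have step: "u k \<in> domJ \<Omega> J \<and> h k < \<infinity>" if x: "?x k \<in> domJ \<Omega> J" for k
    proof -
      have "Y k < \<infinity>" using quot[OF x] by (simp add: Y_def domJ_def)
      then have "ennreal (?lam k) * H f\<delta> f + Y k < \<infinity>"
        using d_fin by (simp add: ennreal_mult_less_top)
      then have "ennreal (?lam k) * h k + J (u k) < \<infinity>"
        using min_z[OF x] by (rule order.strict_trans1[rotated])
      moreover have "u k \<in> L2 \<Omega>"
        using assms(15) by (auto simp: mhdm_minimizers_def is_arg_min_def)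
      ultimately show ?thesis using lam_pos[of k] by (auto simp: domJ_def ennreal_mult_less_top)
    qed
    have x: "?x k \<in> domJ \<Omega> J" for k
      by (induction k) (use one step mult(1) in \<open>auto simp: mhdm_x_prev_Suc\<close>)
    show "?x k \<in> domJ \<Omega> J" "u k \<in> domJ \<Omega> J" "h k < \<infinity>" using x step by auto
  qed
  have Y_fin: "Y k < \<infinity>" and J_fin: "J (u k) < \<infinity>" for k
    using quot[OF x_dom, of k] u_dom[of k] by (auto simp: Y_def domJ_def)
  \<comment> \<open>The factorization of the quotient holds at every point, zeros included, since
    the convention 1 / 0 = 0 keeps inversion multiplicative.\<close>
  have Y_Suc: "Y (Suc k) \<le> Y k + J (u k)" for k
    using mult(2)[OF quot[OF x_dom, of k] inverse(1)[OF u_dom u_dom, of k]]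
      inverse(2)[OF u_dom u_dom, of k]
    by (simp add: Y_def mhdm_x_prev_Suc mult.commute)
  \<comment> \<open>The competitor 1 reproduces the previous iterate at no penalty. The index starts
    at \<open>Suc k\<close> because the iterate before \<open>mhdm_x u 0\<close> is the constant 1,
    whose data term is not a value of \<open>h\<close>.\<close>
  have min_one: "ennreal (?lam (Suc k)) * h (Suc k) + J (u (Suc k)) \<le> ennreal (?lam (Suc k)) * h k" for k
    using mhdm_energy_minimizer_le[OF assms(15), of "\<lambda>t. 1" "Suc k"] one x_dom[of "Suc k"]
    by (simp add: domJ_def h_def mhdm_x_eq_prev)

  \<comment> \<open>\<open>enn2real\<close> sends infinity to 0, so the equations in
    \<open>real\<close> rest on the finiteness shown above.\<close>
  define h' Y' j d where "h' k = enn2real (h k)" and "Y' k = enn2real (Y k)"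
    and "j k = enn2real (J (u k))" and "d = enn2real (H f\<delta> f)" for k
  have real: "h k = ennreal (h' k)" "Y k = ennreal (Y' k)" "J (u k) = ennreal (j k)"
    "H f\<delta> f = ennreal d" for k
    using h_fin Y_fin J_fin d_fin by (auto simp: h'_def Y'_def j_def d_def)
  have nonneg: "h' k \<ge> 0" "Y' k \<ge> 0" "j k \<ge> 0" "d \<ge> 0" "?lam k \<ge> 0" for k
    using lam_pos[of k] by (auto simp: h'_def Y'_def j_def d_def)
  have "h' k \<le> d + 2 * Y' 0 / (real (k + 1) * lam0)" for k
  proof (rule doubling_decay)
    show "lam0 > 0" by fact
    show "?lam k * h' k + j k \<le> ?lam k * d + Y' k" for k
      using min_z[OF x_dom, of k] nonneg
      by (simp add: real ennreal_plus[symmetric] ennreal_mult[symmetric] del: ennreal_plus)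
    show "Y' (Suc k) \<le> Y' k + j k" for k
      using Y_Suc[of k] nonneg by (simp add: real ennreal_plus[symmetric] del: ennreal_plus)
    show "Y' k \<ge> 0" for k by (rule nonneg)
    show "h' (Suc k) \<le> h' k" for k
    proof -
      have "?lam (Suc k) * h' (Suc k) + j (Suc k) \<le> ?lam (Suc k) * h' k"
        using min_one[of k] nonneg(1,3) nonneg(5)[of "Suc k"]
        by (simp add: real ennreal_plus[symmetric] ennreal_mult[symmetric]
            del: ennreal_plus mhdm_lambda.simps)
      then have "?lam (Suc k) * h' (Suc k) \<le> ?lam (Suc k) * h' k"
        using nonneg(3)[of "Suc k"] by linarith
      then show ?thesis using lam_pos[of "Suc k"] mult_le_cancel_left_pos by blast
    qed
  qed
  \<comment> \<open>The noise level enters only here; so far \<open>d\<close> was the exact value of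
    \<open>H f\<delta> f\<close>.\<close>
  moreover have "d \<le> \<delta>\<^sup>2" using assms(13) by (simp add: real)
  ultimately have bound: "h' k \<le> \<delta>\<^sup>2 + 2 * Y' 0 / (real (k + 1) * lam0)" for k
    by (meson add_right_mono order_trans)
  show ?thesis
  proof
    fix k
    \<comment> \<open>\<open>Y 0\<close> is \<open>J z\<close> because the iteration starts from the
      constant 1.\<close>
    have Jz: "J z = ennreal (Y' 0)" using real(2)[of 0] by (simp add: Y_def)
    have "H f\<delta> (T (mhdm_x u k)) = ennreal (h' k)" using real(1) by (simp add: h_def)
    also have "\<dots> \<le> ennreal (\<delta>\<^sup>2 + 2 * Y' 0 / (real (k + 1) * lam0))"
      using bound by (rule ennreal_leI)
    also have "\<dots> = ennreal (\<delta>\<^sup>2) + ennreal (2 * Y' 0 / (real (k + 1) * lam0))"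
      using nonneg(2) assms(14) by (intro ennreal_plus) auto
    also have "ennreal (2 * Y' 0 / (real (k + 1) * lam0)) = 2 * J z / ennreal (real (k + 1) * lam0)"
    proof -
      have "2 * J z = ennreal (2 * Y' 0)" unfolding Jz using nonneg(2) by (simp add: ennreal_mult)
      then show ?thesis using divide_ennreal[of "2 * Y' 0" "real (k + 1) * lam0"] nonneg(2) assms(14)
        by simp
    qed
    finally show "H f\<delta> (T (mhdm_x u k)) \<le> ennreal (\<delta>\<^sup>2) + 2 * J z / ennreal (real (k + 1) * lam0)" .
  qed
qed

end
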